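(* Let $(X_i,Y_i)\in\mathbb{R}^p\times\mathbb{R}$, $i=1,\dots,n$, be sample points, indexed so that $0<Y_1\le\dots\le Y_m$ and $Y_i\le0$ for $i=m+1,\dots,n$. Suppose the One-Node-ReLU problem is realizable, i.e. there exists $(\beta^{\ast},\beta^{\ast}_0)\in\mathbb{R}^p\times\mathbb{R}$ with $$\sum_{i=1}^n\bigl(\max\{0,X_i^{\top}\beta^{\ast}+\beta^{\ast}_0\}-Y_i\bigr)^2=0 .$$ Then the Generalized Approximation Algorithm (described in the context), with a fixed integer parameter $k\ge1$, gives a polynomial-time approach that solves the One-Node-ReLU problem exactly to global optimality; that is, the solution $(\hat\beta,\hat\beta_0)$ it returns is a global minimizer of $\sum_{i=1}^n(\max\{0,X_i^{\top}\beta+\beta_0\}-Y_i)^2$ over $(\beta,\beta_0)\in\mathbb{R}^p\times\mathbb{R}$.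
   Context: The One-Node-ReLU problem is to minimize $\sum_{i=1}^n(\max\{0,X_i^{\top}\beta+\beta_0\}-Y_i)^2$ over $(\beta,\beta_0)\in\mathbb{R}^p\times\mathbb{R}$. Write $[m]=\{1,\dots,m\}$. Define $\sigma(x,y)=(x-y)^2$ if $x>2y$ and $\sigma(x,y)=y^2$ if $x\le 2y$. Define $\phi(\beta,\beta_0)=\sum_{i=m+1}^n(\max\{0,X_i^{\top}\beta+\beta_0\}-Y_i)^2$, and for $I\subseteq[m]$ $$f_I^{\sigma}(\beta,\beta_0)=\sum_{i\in I}(X_i^{\top}\beta+\beta_0-Y_i)^2+\sum_{i\in[m]\setminus I}\sigma(X_i^{\top}\beta+\beta_0,Y_i),\qquad z^{\sigma}(I)=\min_{(\beta,\beta_0)\in\mathbb{R}^p\times\mathbb{R}} f_I^{\sigma}(\beta,\beta_0)+\phi(\beta,\beta_0).$$ Generalized Approximation Algorithm with parameter $k$: for each $j=1,\dots,k$ and each choice of integers $0\le i_1<i_2<\dots<i_j\le m$, take the inactive set to be $\{1,\dots,i_1\}\cup\{i_2,\dots,i_j\}$ (where $\{1,\dots,i_1\}=\emptyset$ if $i_1=0$, and for $j=1$ the inactive set is just $\{1,\dots,i_1\}$), let the active set $I$ be its complement in $[m]$, and compute $z^{\sigma}(I)$ together with a minimizer $(\beta^I,\beta^I_0)$ of the convex function $f_I^{\sigma}+\phi$. Return $(\hat\beta,\hat\beta_0)=(\beta^I,\beta_0^I)$ for an $I$ attaining the smallest value $z^{\sigma}(I)$ among all the sets $I$ examined. Running time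 is measured as $O(n^kT)$, i.e. $O(n^k)$ convex minimizations, where $T$ is the time to minimize one convex function $f_I^{\sigma}+\phi$; for fixed $k$ this is regarded as polynomial time. *)

theory Defs
  imports "HOL-Analysis.Analysis" "HOL-Library.Landau_Symbols"
begin

text \<open>
  Samples are \<open>(X i, Y i)\<close> for \<open>i \<in> {1..n}\<close>; the values of \<open>X\<close> and \<open>Y\<close> at other indices are
  irrelevant.  A parameter is a pair \<open>(\<beta>, \<beta>0)\<close> in \<open>real ^ 'p \<times> real\<close>.
\<close>

definition relu_loss ::
  "(nat \<Rightarrow> real ^ 'p) \<Rightarrow> (nat \<Rightarrow> real) \<Rightarrow> nat set \<Rightarrow> (real ^ 'p) \<times> real \<Rightarrow> real" where
  "relu_loss X Y S = (\<lambda>(\<beta>, \<beta>0). \<Sum>i\<in>S. (max 0 (X i \<bullet> \<beta> + \<beta>0) - Y i)\<^sup>2)"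

definition one_node_relu ::
  "(nat \<Rightarrow> real ^ 'p) \<Rightarrow> (nat \<Rightarrow> real) \<Rightarrow> nat \<Rightarrow> (real ^ 'p) \<times> real \<Rightarrow> real" where
  "one_node_relu X Y n = relu_loss X Y {1..n}"

definition phi ::
  "(nat \<Rightarrow> real ^ 'p) \<Rightarrow> (nat \<Rightarrow> real) \<Rightarrow> nat \<Rightarrow> nat \<Rightarrow> (real ^ 'p) \<times> real \<Rightarrow> real" where
  "phi X Y m n = relu_loss X Y {m+1..n}"

definition sigma :: "real \<Rightarrow> real \<Rightarrow> real" where
  "sigma x y = (if x > 2 * y then (x - y)\<^sup>2 else y\<^sup>2)"

definition f_sigma ::
  "(nat \<Rightarrow> real ^ 'p) \<Rightarrow> (nat \<Rightarrow> real) \<Rightarrow> nat \<Rightarrow> nat set \<Rightarrow> (real ^ 'p) \<times> real \<Rightarrow> real" where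
  "f_sigma X Y m I = (\<lambda>(\<beta>, \<beta>0).
     (\<Sum>i\<in>I. (X i \<bullet> \<beta> + \<beta>0 - Y i)\<^sup>2) +
     (\<Sum>i\<in>{1..m} - I. sigma (X i \<bullet> \<beta> + \<beta>0) (Y i)))"

definition subproblem ::
  "(nat \<Rightarrow> real ^ 'p) \<Rightarrow> (nat \<Rightarrow> real) \<Rightarrow> nat \<Rightarrow> nat \<Rightarrow> nat set \<Rightarrow> (real ^ 'p) \<times> real \<Rightarrow> real" where
  "subproblem X Y m n I = (\<lambda>b. f_sigma X Y m I b + phi X Y m n b)"

text \<open>The subproblems are bounded below by \<open>0\<close>, so the infimum is a genuine one.\<close>

definition z_sigma ::
  "(nat \<Rightarrow> real ^ 'p) \<Rightarrow> (nat \<Rightarrow> real) \<Rightarrow> nat \<Rightarrow> nat \<Rightarrow> nat set \<Rightarrow> real" where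
  "z_sigma X Y m n I = (INF b. subproblem X Y m n I b)"

text \<open>
  A choice \<open>0 \<le> i\<^sub>1 < \<dots> < i\<^sub>j \<le> m\<close> with \<open>1 \<le> j \<le> k\<close> is the strictly increasing list
  \<open>[i\<^sub>1, \<dots>, i\<^sub>j]\<close>.
\<close>

definition index_choices :: "nat \<Rightarrow> nat \<Rightarrow> nat list set" where
  "index_choices k m =
     {s. 1 \<le> length s \<and> length s \<le> k \<and> sorted_wrt (<) s \<and> set s \<subseteq> {0..m}}"

definition inactive_set :: "nat list \<Rightarrow> nat set" where
  "inactive_set s = {1..hd s} \<union> set (tl s)"

definition active_set :: "nat \<Rightarrow> nat list \<Rightarrow> nat set" where
  "active_set m s = {1..m} - inactive_set s"

text \<open>
  An execution is described by the family \<open>b\<close> of minimizers it computes, one for every choice of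
  indices.  Neither these minimizers nor the best choice need be unique, so the output is a relation.
\<close>

definition algorithm_run ::
  "nat \<Rightarrow> (nat \<Rightarrow> real ^ 'p) \<Rightarrow> (nat \<Rightarrow> real) \<Rightarrow> nat \<Rightarrow> nat \<Rightarrow>
     (nat list \<Rightarrow> (real ^ 'p) \<times> real) \<Rightarrow> bool" where
  "algorithm_run k X Y m n b \<longleftrightarrow>
     (\<forall>s\<in>index_choices k m.
        is_arg_min (subproblem X Y m n (active_set m s)) (\<lambda>_. True) (b s))"

definition algorithm_returns ::
  "nat \<Rightarrow> (nat \<Rightarrow> real ^ 'p) \<Rightarrow> (nat \<Rightarrow> real) \<Rightarrow> nat \<Rightarrow> nat \<Rightarrow>
     (real ^ 'p) \<times> real \<Rightarrow> bool" where
  "algorithm_returns k X Y m n bhat \<longleftrightarrow>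
     (\<exists>b s. algorithm_run k X Y m n b \<and>
        is_arg_min (\<lambda>t. z_sigma X Y m n (active_set m t)) (\<lambda>t. t \<in> index_choices k m) s \<and>
        bhat = b s)"

text \<open>
  Cost is counted in minimizations, one for every choice of indices; since \<open>m\<close> depends on the
  instance, the cost for \<open>n\<close> samples is the worst case over \<open>m \<le> n\<close>.
\<close>

definition num_minimizations :: "nat \<Rightarrow> nat \<Rightarrow> nat" where
  "num_minimizations k m = card (index_choices k m)"

definition worst_case_minimizations :: "nat \<Rightarrow> nat \<Rightarrow> nat" where
  "worst_case_minimizations k n = (MAX m\<in>{0..n}. num_minimizations k m)"

end

(* The key is that sigma(x, y) >= y^2 for y > 0, with equality at x = y.  Hence a parameter that fits
   the data exactly minimizes every subproblem at once, and z(I) is the sum of Y_i^2 over the inactive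
   indices.  The choice [0] makes all indices active, with value 0, so a best choice has no inactive
   index with Y_i > 0; the value 0 of its subproblem then forces zero ReLU loss.
   Convexity holds because each summand is the square of a nonnegative convex piecewise affine function. *)

theory Submission
  imports Defs
begin

section \<open>Convexity of the subproblems\<close>

text \<open>Squaring is increasing only on nonnegative reals, so \<open>nonneg\<close> at the convex
  combination allows the convexity inequality of \<open>f\<close> to be squared; convexity of the
  square function does the rest.\<close>

lemma convex_on_power2:
  fixes f :: "'a::real_vector \<Rightarrow> real"
  assumes f: "convex_on S f" and nonneg: "\<And>x. x \<in> S \<Longrightarrow> 0 \<le> f x"
  shows "convex_on S (\<lambda>x. (f x)\<^sup>2)"
proof (rule convex_onI)
  show S: "convex S"
    using f by (rule convex_on_imp_convex)
  fix t :: real and x y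
  assume t: "0 < t" "t < 1" and xy: "x \<in> S" "y \<in> S"
  have "(1 - t) *\<^sub>R x + t *\<^sub>R y \<in> S"
    using S t xy by (simp add: convexD_alt)
  moreover have "f ((1 - t) *\<^sub>R x + t *\<^sub>R y) \<le> (1 - t) * f x + t * f y"
    using convex_onD[OF f] t xy by simp
  ultimately have "(f ((1 - t) *\<^sub>R x + t *\<^sub>R y))\<^sup>2 \<le> ((1 - t) * f x + t * f y)\<^sup>2"
    using nonneg by (intro power_mono)
  also have "\<dots> \<le> (1 - t) * (f x)\<^sup>2 + t * (f y)\<^sup>2"
    using convex_onD[OF convex_power2, of t "f x" "f y"] t by simp
  finally show "(f ((1 - t) *\<^sub>R x + t *\<^sub>R y))\<^sup>2 \<le> (1 - t) * (f x)\<^sup>2 + t * (f y)\<^sup>2" .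
qed

lemma convex_on_max:
  fixes f g :: "'a::real_vector \<Rightarrow> real"
  assumes f: "convex_on S f" and g: "convex_on S g"
  shows "convex_on S (\<lambda>x. max (f x) (g x))"
proof (rule convex_onI)
  show "convex S"
    using f by (rule convex_on_imp_convex)
  fix t :: real and x y
  assume t: "0 < t" "t < 1" and xy: "x \<in> S" "y \<in> S"
  have "f ((1 - t) *\<^sub>R x + t *\<^sub>R y) \<le> (1 - t) * f x + t * f y"
       "g ((1 - t) *\<^sub>R x + t *\<^sub>R y) \<le> (1 - t) * g x + t * g y"
    using convex_onD[OF f] convex_onD[OF g] t xy by simp_all
  moreover have "(1 - t) * f x + t * f y \<le> (1 - t) * max (f x) (g x) + t * max (f y) (g y)"
       "(1 - t) * g x + t * g y \<le> (1 - t) * max (f x) (g x) + t * max (f y) (g y)"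
    using t by (auto intro!: add_mono mult_left_mono)
  ultimately show "max (f ((1 - t) *\<^sub>R x + t *\<^sub>R y)) (g ((1 - t) *\<^sub>R x + t *\<^sub>R y))
      \<le> (1 - t) * max (f x) (g x) + t * max (f y) (g y)"
    by simp
qed

lemma convex_on_sum_fun:
  fixes f :: "'i \<Rightarrow> 'a::real_vector \<Rightarrow> real"
  assumes "convex S" and "\<And>i. i \<in> A \<Longrightarrow> convex_on S (f i)"
  shows "convex_on S (\<lambda>x. \<Sum>i\<in>A. f i x)"
  using assms(2)
  by (induction A rule: infinite_finite_induct) (auto simp: convex_on_const assms(1))

text \<open>The constant \<open>c\<close> makes one rule serve both residuals
  (\<open>c = - y\<close>) and the ReLU argument (\<open>c = 0\<close>).\<close>

lemma convex_on_affine: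
  fixes a :: "'a::real_inner"
  shows "convex_on UNIV (\<lambda>b. a \<bullet> fst b + snd b + c)"
  by (rule convex_onI) (auto simp: inner_add_right algebra_simps)

text \<open>The threshold \<open>x > 2 * y\<close> says exactly that \<open>x - y\<close> exceeds
  \<open>y\<close>.\<close>

lemma sigma_eq_max: "0 < y \<Longrightarrow> sigma x y = (max y (x - y))\<^sup>2"
  by (auto simp: sigma_def max_def)

lemma power2_le_sigma: "0 < y \<Longrightarrow> y\<^sup>2 \<le> sigma x y"
  by (simp add: sigma_eq_max power_mono)

lemma convex_on_sigma:
  fixes a :: "'a::real_inner"
  assumes "0 < y"
  shows "convex_on UNIV (\<lambda>b. sigma (a \<bullet> fst b + snd b) y)"
proof -
  have "convex_on UNIV (\<lambda>b. (max y (a \<bullet> fst b + snd b + (- y)))\<^sup>2)"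
    using assms by (intro convex_on_power2 convex_on_max convex_on_affine) (auto simp: convex_on_const)
  then show ?thesis
    using assms by (simp add: sigma_eq_max)
qed

lemma convex_on_affine_power2:
  fixes a :: "'a::real_inner"
  shows "convex_on UNIV (\<lambda>b. (a \<bullet> fst b + snd b - y)\<^sup>2)"
proof -
  have "convex_on UNIV (\<lambda>b. - (a \<bullet> fst b + snd b + (- y)))"
    by (rule convex_onI) (auto simp: inner_add_right algebra_simps)
  \<comment> \<open>A residual changes sign, so the rule for squares is applied to its absolute
    value, written as a maximum.\<close>
  then have "convex_on UNIV
      (\<lambda>b. (max (a \<bullet> fst b + snd b + (- y)) (- (a \<bullet> fst b + snd b + (- y))))\<^sup>2)"
    by (intro convex_on_power2 convex_on_max convex_on_affine) auto
  moreover have "(max r (- r))\<^sup>2 = r\<^sup>2" for r :: real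
    by (auto simp: max_def)
  ultimately have "convex_on UNIV (\<lambda>b. (a \<bullet> fst b + snd b + (- y))\<^sup>2)"
    by (simp only:)
  then show ?thesis
    by simp
qed

text \<open>For \<open>y > 0\<close> this fails, which is why positive labels are treated through \<open>sigma\<close>.\<close>

lemma convex_on_relu_power2:
  fixes a :: "'a::real_inner"
  assumes "y \<le> 0"
  shows "convex_on UNIV (\<lambda>b. (max 0 (a \<bullet> fst b + snd b) - y)\<^sup>2)"
proof -
  have "convex_on UNIV (\<lambda>b. max 0 (a \<bullet> fst b + snd b + 0) + - y)"
    by (intro convex_on_add convex_on_max convex_on_affine) (auto simp: convex_on_const)
  then have "convex_on UNIV (\<lambda>b. (max 0 (a \<bullet> fst b + snd b + 0) + - y)\<^sup>2)"
    using assms by (intro convex_on_power2) auto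
  then show ?thesis
    by simp
qed

lemma subproblem_eq:
  "subproblem X Y m n I b =
     (\<Sum>i\<in>I. (X i \<bullet> fst b + snd b - Y i)\<^sup>2)
     + (\<Sum>i\<in>{1..m} - I. sigma (X i \<bullet> fst b + snd b) (Y i))
     + (\<Sum>i\<in>{m+1..n}. (max 0 (X i \<bullet> fst b + snd b) - Y i)\<^sup>2)"
  by (simp add: subproblem_def f_sigma_def phi_def relu_loss_def split_def)

lemma convex_on_subproblem:
  assumes "\<And>i. i \<in> {1..m} \<Longrightarrow> 0 < Y i" and "\<And>i. i \<in> {m+1..n} \<Longrightarrow> Y i \<le> 0"
  shows "convex_on UNIV (subproblem X Y m n I)"
  unfolding subproblem_eq using assms
  by (intro convex_on_add convex_on_sum_fun convex_on_affine_power2 convex_on_sigma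
      convex_on_relu_power2) auto

section \<open>The realizable case\<close>

lemma one_node_relu_nonneg: "0 \<le> one_node_relu X Y n b"
  by (auto simp: one_node_relu_def relu_loss_def split_def intro: sum_nonneg)

lemma one_node_relu_eq_0_iff:
  "one_node_relu X Y n b = 0 \<longleftrightarrow> (\<forall>i\<in>{1..n}. max 0 (X i \<bullet> fst b + snd b) = Y i)"
  by (simp add: one_node_relu_def relu_loss_def split_def sum_nonneg_eq_0_iff)

text \<open>The other two sums consist of squares and are dropped, leaving a bound independent of
  \<open>b\<close>.\<close>

lemma inactive_sum_le_subproblem:
  assumes "\<And>i. i \<in> {1..m} \<Longrightarrow> 0 < Y i"
  shows "(\<Sum>i\<in>{1..m} - I. (Y i)\<^sup>2) \<le> subproblem X Y m n I b"
proof -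
  have "(\<Sum>i\<in>{1..m} - I. (Y i)\<^sup>2) \<le> (\<Sum>i\<in>{1..m} - I. sigma (X i \<bullet> fst b + snd b) (Y i))"
    using assms by (intro sum_mono power2_le_sigma) auto
  then show ?thesis
    unfolding subproblem_eq by (simp add: sum_nonneg add_increasing add_increasing2)
qed

lemma subproblem_realizable:
  assumes pos: "\<And>i. i \<in> {1..m} \<Longrightarrow> 0 < Y i" and "m \<le> n" and "I \<subseteq> {1..m}"
    and zero: "one_node_relu X Y n b = 0"
  shows "subproblem X Y m n I b = (\<Sum>i\<in>{1..m} - I. (Y i)\<^sup>2)"
proof -
  have fit: "max 0 (X i \<bullet> fst b + snd b) = Y i" if "i \<in> {1..n}" for i
    using zero that by (simp add: one_node_relu_eq_0_iff)
  \<comment> \<open>A positive label cannot be matched by the flat part of the ReLU, so the fit is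
    linear here.\<close>
  have active: "X i \<bullet> fst b + snd b = Y i" if "i \<in> {1..m}" for i
    using fit[of i] pos[of i] that \<open>m \<le> n\<close> by (auto simp: max_def split: if_splits)
  have "(\<Sum>i\<in>I. (X i \<bullet> fst b + snd b - Y i)\<^sup>2) = 0"
    using active \<open>I \<subseteq> {1..m}\<close> by (intro sum.neutral) auto
  moreover have "(\<Sum>i\<in>{m+1..n}. (max 0 (X i \<bullet> fst b + snd b) - Y i)\<^sup>2) = 0"
    using fit by (intro sum.neutral) auto
  \<comment> \<open>At \<open>x = y > 0\<close> the test \<open>x > 2 * y\<close> fails, so
    \<open>sigma\<close> is on its constant branch.\<close>
  moreover have "(\<Sum>i\<in>{1..m} - I. sigma (X i \<bullet> fst b + snd b) (Y i)) = (\<Sum>i\<in>{1..m} - I. (Y i)\<^sup>2)"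
    using active pos by (intro sum.cong) (auto simp: sigma_def)
  ultimately show ?thesis
    unfolding subproblem_eq by simp
qed

text \<open>Clipping a negative prediction to 0 brings it closer to a positive label, so each linear
  residual dominates the ReLU residual.\<close>

lemma one_node_relu_le_subproblem:
  assumes "\<And>i. i \<in> {1..m} \<Longrightarrow> 0 < Y i" and "m \<le> n"
  shows "one_node_relu X Y n b \<le> subproblem X Y m n {1..m} b"
proof -
  have "{1..n} = {1..m} \<union> {m+1..n}"
    using \<open>m \<le> n\<close> by auto
  then have "one_node_relu X Y n b =
      (\<Sum>i\<in>{1..m}. (max 0 (X i \<bullet> fst b + snd b) - Y i)\<^sup>2)
      + (\<Sum>i\<in>{m+1..n}. (max 0 (X i \<bullet> fst b + snd b) - Y i)\<^sup>2)"
    unfolding one_node_relu_def relu_loss_def split_def by (simp add: sum.union_disjoint)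
  moreover have "(\<Sum>i\<in>{1..m}. (max 0 (X i \<bullet> fst b + snd b) - Y i)\<^sup>2)
      \<le> (\<Sum>i\<in>{1..m}. (X i \<bullet> fst b + snd b - Y i)\<^sup>2)"
  proof (rule sum_mono)
    fix i assume "i \<in> {1..m}"
    then have "0 < Y i" using assms(1) by simp
    then show "(max 0 (X i \<bullet> fst b + snd b) - Y i)\<^sup>2 \<le> (X i \<bullet> fst b + snd b - Y i)\<^sup>2"
      by (intro abs_le_square_iff[THEN iffD1]) (auto simp: max_def)
  qed
  ultimately show ?thesis
    unfolding subproblem_eq by simp
qed

section \<open>Counting the index choices\<close>

text \<open>Forgetting monotonicity leaves all lists of length at most \<open>k\<close> over
  \<open>m + 1\<close> values; each of the \<open>k + 1\<close> lengths contributes at most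
  \<open>(m + 1) ^ k\<close>.\<close>

lemma num_minimizations_le: "num_minimizations k m \<le> (k + 1) * (m + 1) ^ k"
proof -
  have "index_choices k m \<subseteq> {s. set s \<subseteq> {0..m} \<and> length s \<le> k}"
    by (auto simp: index_choices_def)
  then have "num_minimizations k m \<le> card {s. set s \<subseteq> {0..m} \<and> length s \<le> k}"
    unfolding num_minimizations_def by (intro card_mono finite_lists_length_le) auto
  also have "\<dots> = (\<Sum>i\<le>k. (m + 1) ^ i)"
    by (simp add: card_lists_length_le)
  also have "\<dots> \<le> (\<Sum>i\<le>k. (m + 1) ^ k)"
    by (intro sum_mono power_increasing) auto
  finally show ?thesis
    by simp
qed

lemma worst_case_minimizations_le: "worst_case_minimizations k n \<le> (k + 1) * (n + 1) ^ k"
  unfolding worst_case_minimizations_def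
proof (rule Max.boundedI)
  fix c assume "c \<in> num_minimizations k ` {0..n}"
  then obtain m where "m \<le> n" "c = num_minimizations k m"
    by auto
  then have "c \<le> (k + 1) * (m + 1) ^ k"
    using num_minimizations_le by simp
  also have "\<dots> \<le> (k + 1) * (n + 1) ^ k"
    using \<open>m \<le> n\<close> by (intro mult_left_mono power_mono) auto
  finally show "c \<le> (k + 1) * (n + 1) ^ k" .
qed auto

lemma worst_case_minimizations_bigo:
  "(\<lambda>n. real (worst_case_minimizations k n)) \<in> O(\<lambda>n. real n ^ k)"
proof (rule bigoI)
  show "\<forall>\<^sub>F n in sequentially. norm (real (worst_case_minimizations k n))
      \<le> (real (k + 1) * 2 ^ k) * norm (real n ^ k)"
  proof (rule eventually_sequentiallyI)
    fix n :: nat assume "1 \<le> n"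
    have "worst_case_minimizations k n \<le> (k + 1) * (n + 1) ^ k"
      by (rule worst_case_minimizations_le)
    \<comment> \<open>For \<open>n \<ge> 1\<close>, \<open>n + 1 \<le> 2 * n\<close>; this is the
      source of the factor \<open>2 ^ k\<close>.\<close>
    also have "\<dots> \<le> (k + 1) * (2 * n) ^ k"
      using \<open>1 \<le> n\<close> by (intro mult_left_mono power_mono) auto
    finally have "real (worst_case_minimizations k n) \<le> real ((k + 1) * (2 * n) ^ k)"
      by (rule of_nat_mono)
    then show "norm (real (worst_case_minimizations k n))
        \<le> (real (k + 1) * 2 ^ k) * norm (real n ^ k)"
      by (simp add: power_mult_distrib algebra_simps)
  qed
qed

text \<open>The first conjunct keeps the second from being vacuous; the third justifies counting the
  computations as convex minimizations.\<close>

theorem corollary1: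
  fixes X :: "nat \<Rightarrow> real ^ 'p" and Y :: "nat \<Rightarrow> real" and k m n :: nat
  assumes "1 \<le> k"
    and "m \<le> n"
    and "\<forall>i\<in>{1..m}. 0 < Y i"
    and "mono_on {1..m} Y"
    and "\<forall>i\<in>{m+1..n}. Y i \<le> 0"
    and realizable: "\<exists>\<beta> \<beta>0. one_node_relu X Y n (\<beta>, \<beta>0) = 0"
  shows "(\<exists>bhat. algorithm_returns k X Y m n bhat)
    \<and> (\<forall>bhat. algorithm_returns k X Y m n bhat \<longrightarrow>
          is_arg_min (one_node_relu X Y n) (\<lambda>_. True) bhat)
    \<and> (\<forall>s\<in>index_choices k m. convex_on UNIV (subproblem X Y m n (active_set m s)))
    \<and> (\<lambda>N. real (worst_case_minimizations k N)) \<in> O(\<lambda>N. real N ^ k)"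
proof (intro conjI allI impI ballI)
  have pos: "\<And>i. i \<in> {1..m} \<Longrightarrow> 0 < Y i"
    using assms by simp
  obtain bs where bs: "one_node_relu X Y n bs = 0"
    using realizable by blast
  have active_subset: "active_set m s \<subseteq> {1..m}" for s
    by (auto simp: active_set_def)
  define v where "v s = (\<Sum>i\<in>{1..m} - active_set m s. (Y i)\<^sup>2)" for s
  have at_bs: "subproblem X Y m n (active_set m s) bs = v s" for s
    unfolding v_def using pos \<open>m \<le> n\<close> active_subset bs by (intro subproblem_realizable)
  have lower: "v s \<le> subproblem X Y m n (active_set m s) b" for s b
    unfolding v_def using pos by (intro inactive_sum_le_subproblem)
  \<comment> \<open>The lower bound \<open>v s\<close> is attained at \<open>bs\<close>, so the
    infimum is a minimum.\<close>
  have z_eq: "z_sigma X Y m n (active_set m s) = v s" for s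
    unfolding z_sigma_def
  proof (rule cInf_eq_minimum)
    show "v s \<in> range (subproblem X Y m n (active_set m s))"
      using at_bs[of s, symmetric] by (rule range_eqI)
  qed (use lower in auto)
  have all_active: "active_set m [0] = {1..m}"
    by (simp add: active_set_def inactive_set_def)
  have v0: "v [0] = 0"
    by (simp add: v_def all_active)
  have v_nonneg: "0 \<le> v s" for s
    by (simp add: v_def sum_nonneg)
  \<comment> \<open>A list of length one is admissible because \<open>k \<ge> 1\<close>.\<close>
  have mem0: "[0] \<in> index_choices k m"
    using \<open>1 \<le> k\<close> by (simp add: index_choices_def)
  \<comment> \<open>The exact fit \<open>bs\<close> minimizes every subproblem, so the constant
    family is a valid run.\<close>
  have "algorithm_run k X Y m n (\<lambda>_. bs)"
    by (simp add: algorithm_run_def is_arg_min_linorder at_bs lower)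
  moreover have "is_arg_min (\<lambda>t. z_sigma X Y m n (active_set m t)) (\<lambda>t. t \<in> index_choices k m) [0]"
    by (simp add: is_arg_min_linorder z_eq v0 v_nonneg mem0)
  ultimately show "\<exists>bhat. algorithm_returns k X Y m n bhat"
    unfolding algorithm_returns_def by blast
  show "is_arg_min (one_node_relu X Y n) (\<lambda>_. True) bhat"
    if returned: "algorithm_returns k X Y m n bhat" for bhat
  proof -
    obtain b s where run: "algorithm_run k X Y m n b"
      and best: "is_arg_min (\<lambda>t. z_sigma X Y m n (active_set m t)) (\<lambda>t. t \<in> index_choices k m) s"
      and bhat: "bhat = b s"
      using returned unfolding algorithm_returns_def by blast
    have s: "s \<in> index_choices k m" and "v s \<le> v [0]"
      using best mem0 by (auto simp: is_arg_min_linorder z_eq)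
    then have "v s = 0"
      using v0 v_nonneg[of s] by simp
    then have "\<forall>i\<in>{1..m} - active_set m s. Y i = 0"
      by (simp add: v_def sum_nonneg_eq_0_iff)
    \<comment> \<open>An inactive index would have label 0, contradicting
      \<open>pos\<close>.\<close>
    then have active: "active_set m s = {1..m}"
      using pos active_subset[of s] by force
    \<comment> \<open>The returned minimizer may differ from \<open>bs\<close>; only its value is
      compared.\<close>
    have "subproblem X Y m n (active_set m s) bhat \<le> subproblem X Y m n (active_set m s) bs"
      using run s unfolding algorithm_run_def bhat is_arg_min_linorder by blast
    then have "subproblem X Y m n {1..m} bhat \<le> 0"
      using at_bs[of s] \<open>v s = 0\<close> active by simp
    then have "one_node_relu X Y n bhat \<le> 0"
      using one_node_relu_le_subproblem[of m Y n X bhat] pos \<open>m \<le> n\<close> by simp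
    then show ?thesis
      by (auto simp: is_arg_min_linorder intro: order_trans one_node_relu_nonneg)
  qed
  show "convex_on UNIV (subproblem X Y m n (active_set m s))" for s
    using assms by (intro convex_on_subproblem) auto
  show "(\<lambda>N. real (worst_case_minimizations k N)) \<in> O(\<lambda>N. real N ^ k)"
    by (rule worst_case_minimizations_bigo)
qed

end
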